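(* Let $k\in\mathbb{N}$ and let $\{b_{I,i}: I=[s,t)\subset[0,\infty)\}$, $i=1,2,\dots,k$, be a freely independent family of $k$ compound free Poisson processes such that $\kappa_n(b_{I,i})=|I|m_n(\nu_i)$ for all $n\ge1$, where $\nu_i$ is a compactly supported probability measure on $\mathbb{R}$, $i=1,\dots,k$. Then the sum $b_I=\sum_{i=1}^k b_{I,i}$ is a compound free Poisson process with distribution $\kappa_n(b_I)=k|I|m_n(\nu)$, $n\ge1$, where $\nu=\sum_{i=1}^k\frac{\nu_i}{k}$.
   Context: All elements lie in a $*$-non-commutative probability space $(\mathcal{A},\varphi)$ (unital $*$-algebra with a positive unital linear functional). $|I|$ is the length of $I$; $m_n(\nu)$ is the $n$-th moment of $\nu$; $\kappa_n$ are the usual free cumulants and $\kappa_n(a):=\kappa_n(a,\dots,a)$. The $k$ processes being freely independent means that the unital subalgebras generated by $\{b_{I,i}\}_I$, $i=1,\dots,k$, are freely independent. Compound free Poisson process: for a compactly supported probability measure $\nu$ on $\mathbb{R}$ and $k\in\mathbb{N}$, a family $\{a_I: I=[s,t)\subset[0,\infty)\}$ of self-adjoint elements in a $*$-non-commutative probability space is a compound free Poisson process with respect to $\nu$ if (1) $\kappa_n(a_I)=k|I|m_n(\nu)$ for all $n\ge1$ and all $I$; (2) if $I_1,\dots,I_n$ are mutually disjoint half-open intervals, then $a_{I_1},\dots,a_{I_n}$ are freely independent. *)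

theory Defs
  imports "HOL-Probability.Probability" "HOL-Library.Disjoint_Sets"
begin

section \<open>\<open>*\<close>-non-commutative probability spaces\<close>

text \<open>
  The *-algebra is a whole type of class \<open>ring_1\<close> with an explicit complex scalar
  multiplication and involution.
\<close>

locale star_probability_space = vector_space smul
  for smul :: "complex \<Rightarrow> 'a::ring_1 \<Rightarrow> 'a" +
  fixes star :: "'a \<Rightarrow> 'a" and \<phi> :: "'a \<Rightarrow> complex"
  assumes scale_mult_left: "smul c a * b = smul c (a * b)"
    and scale_mult_right: "a * smul c b = smul c (a * b)"
    and star_star: "star (star a) = a"
    and star_add: "star (a + b) = star a + star b"
    and star_scale: "star (smul c a) = smul (cnj c) (star a)"
    and star_mult: "star (a * b) = star b * star a"
    and state_linear: "Vector_Spaces.linear smul (*) \<phi>"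
    and state_one: "\<phi> 1 = 1"
    and state_positive: "\<phi> (star a * a) \<in> \<real>\<^sub>\<ge>\<^sub>0"

definition self_adjoint :: "('a \<Rightarrow> 'a) \<Rightarrow> 'a \<Rightarrow> bool" where
  "self_adjoint star a \<longleftrightarrow> star a = a"

section \<open>Free independence\<close>

definition unital_subalgebra :: "(complex \<Rightarrow> 'a \<Rightarrow> 'a) \<Rightarrow> 'a::ring_1 set \<Rightarrow> bool" where
  "unital_subalgebra smul S \<longleftrightarrow>
     module.subspace smul S \<and> 1 \<in> S \<and> (\<forall>a\<in>S. \<forall>b\<in>S. a * b \<in> S)"

definition generated_subalgebra :: "(complex \<Rightarrow> 'a \<Rightarrow> 'a) \<Rightarrow> 'a set \<Rightarrow> 'a::ring_1 set" where
  "generated_subalgebra smul X = unital_subalgebra smul hull X"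

text \<open>
  The empty word is excluded because its product is \<open>1\<close>.
\<close>

definition free_subalgebras ::
  "('a::ring_1 \<Rightarrow> complex) \<Rightarrow> 'i set \<Rightarrow> ('i \<Rightarrow> 'a set) \<Rightarrow> bool" where
  "free_subalgebras \<phi> J A \<longleftrightarrow>
     (\<forall>js as. js \<noteq> [] \<and> set js \<subseteq> J \<and> distinct_adj js \<and>
        list_all2 (\<lambda>j a. a \<in> A j \<and> \<phi> a = 0) js as \<longrightarrow> \<phi> (prod_list as) = 0)"

definition free_elements ::
  "(complex \<Rightarrow> 'a \<Rightarrow> 'a) \<Rightarrow> ('a::ring_1 \<Rightarrow> complex) \<Rightarrow> 'i set \<Rightarrow> ('i \<Rightarrow> 'a) \<Rightarrow> bool" where
  "free_elements smul \<phi> J a \<longleftrightarrow>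
     free_subalgebras \<phi> J (\<lambda>j. generated_subalgebra smul {a j})"

section \<open>Free cumulants\<close>

definition noncrossing :: "nat set set \<Rightarrow> bool" where
  "noncrossing P \<longleftrightarrow>
     \<not> (\<exists>V\<in>P. \<exists>W\<in>P. V \<noteq> W \<and>
          (\<exists>p q r s. p < q \<and> q < r \<and> r < s \<and> p \<in> V \<and> r \<in> V \<and> q \<in> W \<and> s \<in> W))"

definition NC :: "nat \<Rightarrow> nat set set set" where
  "NC n = {P. partition_on {..<n} P \<and> noncrossing P}"

text \<open>
  The free cumulant \<open>\<kappa>\<^sub>n(a\<^sub>1, \<dots>, a\<^sub>n)\<close> of the list \<open>[a\<^sub>1, \<dots>, a\<^sub>n]\<close>: this is the
  moment-cumulant formula (lemma \<open>moment_cumulant\<close>), solved for the term of the one-block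
  partition. Positions are counted from 0, and \<open>nths as V\<close> is the sublist of \<open>as\<close> at the
  positions in \<open>V\<close>, in increasing order.
\<close>

function free_cumulant :: "('a::ring_1 \<Rightarrow> complex) \<Rightarrow> 'a list \<Rightarrow> complex" where
  "free_cumulant \<phi> as = \<phi> (prod_list as) -
     (\<Sum>P\<in>NC (length as) - {{{..<length as}}}. \<Prod>V\<in>P. free_cumulant \<phi> (nths as V))"
  by pat_completeness auto
termination
proof (relation "Wellfounded.measure (\<lambda>(\<phi>, as). length as)", goal_cases)
  case 1
  then show ?case by simp
next
  case (2 \<phi> as P V)
  from 2(1) have part: "partition_on {..<length as} P" and ne: "P \<noteq> {{..<length as}}"
    by (auto simp: NC_def)
  have sub: "V \<subseteq> {..<length as}"
    using part 2(2) by (auto simp: partition_on_def)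
  have "V \<noteq> {..<length as}"
  proof
    assume V: "V = {..<length as}"
    have "W = V" if "W \<in> P" for W
    proof (rule ccontr)
      assume "W \<noteq> V"
      then have "W \<inter> V = {}"
        using part 2(2) that by (auto simp: partition_on_def disjoint_def)
      moreover have "W \<subseteq> V" "W \<noteq> {}"
        using part that V by (auto simp: partition_on_def)
      ultimately show False by blast
    qed
    then have "P = {{..<length as}}" using 2(2) V by blast
    with ne show False by simp
  qed
  with sub have "V \<subset> {..<length as}" by blast
  then have "card V < length as"
    using psubset_card_mono[of "{..<length as}" V] by simp
  moreover have "{i. i < length as \<and> i \<in> V} = V" using sub by auto
  ultimately show ?case by (simp add: length_nths)
qed

declare free_cumulant.simps [simp del]

lemma finite_NC: "finite (NC n)"
  by (rule finite_subset[of _ "Pow (Pow {..<n})"]) (auto simp: NC_def partition_on_def)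

lemma moment_cumulant:
  assumes "as \<noteq> []"
  shows "\<phi> (prod_list as) = (\<Sum>P\<in>NC (length as). \<Prod>V\<in>P. free_cumulant \<phi> (nths as V))"
proof -
  have "partition_on {..<length as} {{..<length as}}"
    using assms by (intro partition_on_space) auto
  then have top: "{{..<length as}} \<in> NC (length as)"
    by (auto simp: NC_def noncrossing_def)
  have "nths as {..<length as} = as"
    by (simp add: nths_all)
  then show ?thesis
    by (simp add: sum.remove[OF finite_NC top] free_cumulant.simps[of \<phi> as])
qed

section \<open>Measures on the real line\<close>

definition measure_support :: "real measure \<Rightarrow> real set" where
  "measure_support \<nu> = {x. \<forall>U. open U \<and> x \<in> U \<longrightarrow> emeasure \<nu> U > 0}"

definition compactly_supported_distribution :: "real measure \<Rightarrow> bool" where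
  "compactly_supported_distribution \<nu> \<longleftrightarrow> real_distribution \<nu> \<and> compact (measure_support \<nu>)"

definition moment :: "real measure \<Rightarrow> nat \<Rightarrow> real" where
  "moment \<nu> n = (\<integral>x. x ^ n \<partial>\<nu>)"

definition average_measure :: "nat \<Rightarrow> (nat \<Rightarrow> real measure) \<Rightarrow> real measure" where
  "average_measure k \<nu> =
     measure_of UNIV (sets borel) (\<lambda>A. \<Sum>i=1..k. emeasure (\<nu> i) A / of_nat k)"

lemma emeasure_average_measure:
  assumes sets: "\<And>i. i \<in> {1..k} \<Longrightarrow> sets (\<nu> i) = sets borel" and A: "A \<in> sets borel"
  shows "emeasure (average_measure k \<nu>) A = (\<Sum>i=1..k. emeasure (\<nu> i) A / of_nat k)"
  unfolding average_measure_def
proof (rule emeasure_measure_of_sigma)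
  show "sigma_algebra UNIV (sets (borel :: real measure))"
    using sets.sigma_algebra_axioms[of "borel :: real measure"] by simp
  show "positive (sets borel) (\<lambda>A. \<Sum>i=1..k. emeasure (\<nu> i) A / of_nat k)"
    by (simp add: positive_def)
  show "countably_additive (sets borel) (\<lambda>A. \<Sum>i=1..k. emeasure (\<nu> i) A / of_nat k)"
  proof (rule countably_additiveI)
    fix B :: "nat \<Rightarrow> real set"
    assume B: "range B \<subseteq> sets borel" "disjoint_family B" "\<Union>(range B) \<in> sets borel"
    have "(\<Sum>n. \<Sum>i=1..k. emeasure (\<nu> i) (B n) / of_nat k) =
          (\<Sum>i=1..k. \<Sum>n. emeasure (\<nu> i) (B n) / of_nat k)"
      by (rule suminf_sum) simp
    also have "\<dots> = (\<Sum>i=1..k. (\<Sum>n. emeasure (\<nu> i) (B n)) / of_nat k)"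
      by (simp add: divide_ennreal_def)
    also have "\<dots> = (\<Sum>i=1..k. emeasure (\<nu> i) (\<Union>(range B)) / of_nat k)"
      using B sets by (intro sum.cong refl) (simp add: suminf_emeasure)
    finally show "(\<Sum>n. \<Sum>i=1..k. emeasure (\<nu> i) (B n) / of_nat k) =
          (\<Sum>i=1..k. emeasure (\<nu> i) (\<Union>(range B)) / of_nat k)" .
  qed
  show "A \<in> sets borel" by (rule A)
qed

section \<open>Compound free Poisson processes\<close>

definition half_open_intervals :: "real set set" where
  "half_open_intervals = {{s..<t} | s t. 0 \<le> s \<and> s < t}"

text \<open>
  A process is a function on all sets of reals; only its values on
  \<^const>\<open>half_open_intervals\<close> matter. The length of an interval is its Lebesgue measure.
\<close>

definition compound_free_poisson_process ::
  "(complex \<Rightarrow> 'a \<Rightarrow> 'a) \<Rightarrow> ('a \<Rightarrow> 'a) \<Rightarrow> ('a::ring_1 \<Rightarrow> complex) \<Rightarrow>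
   nat \<Rightarrow> real measure \<Rightarrow> (real set \<Rightarrow> 'a) \<Rightarrow> bool" where
  "compound_free_poisson_process smul star \<phi> k \<nu> a \<longleftrightarrow>
     compactly_supported_distribution \<nu> \<and>
     (\<forall>I\<in>half_open_intervals. self_adjoint star (a I)) \<and>
     (\<forall>I\<in>half_open_intervals. \<forall>n\<ge>1.
        free_cumulant \<phi> (replicate n (a I)) =
          of_real (real k * measure lborel I * moment \<nu> n)) \<and>
     (\<forall>(n::nat) I. (\<forall>j<n. I j \<in> half_open_intervals) \<and> disjoint_family_on I {..<n} \<longrightarrow>
        free_elements smul \<phi> {..<n} (\<lambda>j. a (I j)))"

end

theory Submission
  imports Defs
begin

text \<open>
  Three things make the sum of freely independent compound free Poisson processes into one with
  the averaged jump law.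

  The cumulants. For freely independent elements cumulants add (\<open>free_cumulant_sum\<close>), so that
  \<open>\<kappa>\<^sub>n(b\<^sub>I) = \<bar>I\<bar> \<Sum>\<^sub>i m\<^sub>n(\<nu>\<^sub>i)\<close>, which is
  \<open>k \<bar>I\<bar> m\<^sub>n(\<nu>)\<close> by \<open>moment_average_measure\<close>. Additivity is obtained without mixed cumulants. Write
  \<open>C\<^sub>a(w) = \<Sum>\<^sub>n \<kappa>\<^sub>n(a) w\<^sup>n\<close> (sum over \<open>n \<ge> 1\<close>). In the power series over the algebra,
  \<open>C\<^sub>a\<close> is the only scalar series \<open>C\<close> without constant term for which \<open>X = (1 + C(w) - w a)\<^sup>-\<^sup>1\<close> has
  \<open>\<phi>(X) = 1\<close>, coefficient by coefficient; this is the relation \<open>G(1/w + R(w)) = w\<close> between the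
  Cauchy transform and the R-transform. That \<open>C\<^sub>a\<close> has the property is the combinatorial
  part (\<open>nc_weight_Suc\<close>, \<open>phi_fps_pencil_inverse\<close>), and uniqueness is a resolvent identity
  (\<open>cumulant_fps_unique\<close>). If \<open>X\<close>, \<open>Y\<close> are these inverses for free \<open>a\<close>, \<open>b\<close>, and
  \<open>E = 1 - X\<close>, \<open>F = 1 - Y\<close>, then
  \<open>1 + C\<^sub>a + C\<^sub>b - w (a + b) = X\<^sup>-\<^sup>1 + Y\<^sup>-\<^sup>1 - 1 = X\<^sup>-\<^sup>1 (1 - E F) Y\<^sup>-\<^sup>1\<close>,
  whose inverse \<open>(1 - F) (1 - E F)\<^sup>-\<^sup>1 (1 - E)\<close> is \<open>1\<close> plus a signed sum of alternating words in the
  centred series \<open>E\<close>, \<open>F\<close>. Freeness annihilates these words, hence \<open>C\<^sub>a + C\<^sub>b\<close> has the property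
  that characterises \<open>C\<^sub>a\<^sub>+\<^sub>b\<close> (\<open>cumulant_fps_add\<close>).

  The increments. Free independence is associative in both directions: free algebras may be
  refined by free subalgebras (\<open>free_subalgebras_refine\<close>), and a free family may be grouped
  (\<open>free_subalgebras_group\<close>). So for disjoint intervals all the elements \<open>b\<^sub>i(I\<^sub>j)\<close> are free over
  the pairs \<open>(i, j)\<close>, and grouping them by \<open>j\<close> makes the sums over \<open>i\<close> free.

  The jump law. Compact support makes all powers integrable, so the moments of the average are the
  averages of the moments. The support of the average is the union of the finitely many compact
  supports (\<open>measure_support_average_measure\<close>).
\<close>

unbundle no vec_syntax
unbundle fps_syntax

section \<open>Weighted counts of noncrossing partitions\<close>

text \<open>
  Partitions in which no block lies entirely in \<open>{p..}\<close>. They interpolate between all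
  of \<open>NC n\<close> (at \<open>p = n\<close>) and nothing (at \<open>p = 0 < n\<close>). Their weights turn out to be the values
  \<open>\<phi>(a\<^sup>p X\<^sub>q)\<close> with \<open>n = p + q\<close>, for the coefficients \<open>X\<^sub>q\<close> of the inverse of \<open>1 + C(w) - w a\<close>:
  multiplying by \<open>X\<^sub>q\<close> instead of \<open>a\<^sup>q\<close> discards
  the partitions with a block inside the last \<open>q\<close> positions.
\<close>

definition NC_reaching :: "nat \<Rightarrow> nat \<Rightarrow> nat set set set" where
  "NC_reaching p n = {P \<in> NC n. \<forall>V\<in>P. \<exists>x\<in>V. x < p}"

definition nc_weight :: "(nat \<Rightarrow> complex) \<Rightarrow> nat \<Rightarrow> nat \<Rightarrow> complex" where
  "nc_weight \<kappa> p n = (\<Sum>P\<in>NC_reaching p n. \<Prod>V\<in>P. \<kappa> (card V))"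

text \<open>
  The increasing bijection from the positions to those outside \<open>{p..<p + j}\<close>; it transports
  partitions when an interval block is inserted.
\<close>

definition skip :: "nat \<Rightarrow> nat \<Rightarrow> nat \<Rightarrow> nat" where
  "skip p j x = (if x < p then x else x + j)"

lemma skip_strict_mono: "strict_mono (skip p j)"
  by (auto simp: strict_mono_def skip_def)

lemma skip_inj: "inj (skip p j)"
  by (rule strict_mono_imp_inj_on[OF skip_strict_mono])

lemma skip_less_iff: "skip p j x < p \<longleftrightarrow> x < p"
  by (auto simp: skip_def)

lemma skip_range: "range (skip p j) = - {p..<p + j}"
proof -
  have "y \<in> range (skip p j)" if "y \<notin> {p..<p + j}" for y
    by (rule range_eqI[of _ _ "if y < p then y else y - j"]) (use that in \<open>auto simp: skip_def\<close>)
  moreover have "skip p j x \<notin> {p..<p + j}" for x by (simp add: skip_def)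
  ultimately show ?thesis by blast
qed

lemma skip_image_lessThan:
  assumes "p + j \<le> n"
  shows "skip p j ` {..<n - j} = {..<n} - {p..<p + j}"
proof -
  have "y \<in> skip p j ` {..<n - j}" if "y \<in> {..<n} - {p..<p + j}" for y
    by (rule image_eqI[of _ _ "if y < p then y else y - j"])
      (use that assms in \<open>auto simp: skip_def\<close>)
  moreover have "skip p j x \<in> {..<n} - {p..<p + j}" if "x < n - j" for x
    using that assms by (auto simp: skip_def)
  ultimately show ?thesis by blast
qed

lemma inj_image_set: "inj f \<Longrightarrow> inj_on ((`) f) S"
  by (auto simp: inj_on_def inj_image_eq_iff)

lemma partition_on_inj_image_iff:
  assumes "inj f"
  shows "partition_on (f ` A) ((`) f ` P) \<longleftrightarrow> partition_on A P"
proof -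
  have "\<Union> ((`) f ` P) = f ` \<Union>P" by auto
  then show ?thesis using assms
    by (auto simp: partition_on_def disjoint_def inj_image_eq_iff simp flip: image_Int)
qed

lemma noncrossing_strict_mono_image:
  assumes "strict_mono (f :: nat \<Rightarrow> nat)"
  shows "noncrossing ((`) f ` P) \<longleftrightarrow> noncrossing P"
proof -
  have "inj f" using assms by (rule strict_mono_imp_inj_on)
  then have ne: "f ` V \<noteq> f ` W \<longleftrightarrow> V \<noteq> W" for V W by (simp add: inj_image_eq_iff)
  have "(\<exists>p q r s. p < q \<and> q < r \<and> r < s \<and> p \<in> f ` V \<and> r \<in> f ` V \<and> q \<in> f ` W \<and> s \<in> f ` W) \<longleftrightarrow>
      (\<exists>p q r s. p < q \<and> q < r \<and> r < s \<and> p \<in> V \<and> r \<in> V \<and> q \<in> W \<and> s \<in> W)"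
    (is "?L \<longleftrightarrow> ?R") for V W
  proof
    assume ?L
    then show ?R using strict_mono_less[OF assms] by blast
  next
    assume ?R
    then obtain p q r s where "p < q \<and> q < r \<and> r < s \<and> p \<in> V \<and> r \<in> V \<and> q \<in> W \<and> s \<in> W" by blast
    then show ?L
      by (intro exI[of _ "f p"] exI[of _ "f q"] exI[of _ "f r"] exI[of _ "f s"])
        (simp add: strict_mono_less[OF assms])
  qed
  then show ?thesis by (simp add: noncrossing_def ne)
qed

text \<open>
  In a crossing, each of the two blocks has a point of the other one between two of its own. An
  interval leaves no room for that.
\<close>

lemma noncrossing_insert_interval:
  assumes "\<And>W. W \<in> P \<Longrightarrow> W \<inter> {a..<b} = {}"
  shows "noncrossing (insert {a..<b} P) \<longleftrightarrow> noncrossing P"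
proof
  show "noncrossing (insert {a..<b} P)" if nc: "noncrossing P"
    unfolding noncrossing_def
  proof (intro notI, elim bexE exE conjE)
    fix V W p q r s
    assume h: "V \<in> insert {a..<b} P" "W \<in> insert {a..<b} P" "V \<noteq> W"
      "p < q" "q < r" "r < s" "p \<in> V" "r \<in> V" "q \<in> W" "s \<in> W"
    consider "V \<in> P" "W \<in> P" | "V = {a..<b}" "W \<in> P" | "W = {a..<b}" "V \<in> P"
      using h by blast
    then show False
    proof cases
      case 1
      with h nc show ?thesis unfolding noncrossing_def by blast
    next
      case 2
      with h have "q \<in> W \<inter> {a..<b}" by auto
      with 2 assms show ?thesis by blast
    next
      case 3
      with h have "r \<in> V \<inter> {a..<b}" by auto
      with 3 assms show ?thesis by blast
    qed
  qed
qed (auto simp: noncrossing_def)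

text \<open>
  The partitions gained on passing from \<open>NC_reaching p n\<close> to \<open>NC_reaching (Suc p) n\<close>, sorted by the
  length \<open>j\<close> of the one block without a position below \<open>p\<close>.
\<close>

definition NC_ending :: "nat \<Rightarrow> nat \<Rightarrow> nat \<Rightarrow> nat set set set" where
  "NC_ending p j n =
     {P \<in> NC n. {p..<p + j} \<in> P \<and> (\<forall>V\<in>P - {{p..<p + j}}. \<exists>x\<in>V. x < p)}"

lemma insert_interval_NC_iff:
  assumes "1 \<le> j" "p + j \<le> n"
  shows "insert {p..<p + j} ((`) (skip p j) ` P) \<in> NC n \<longleftrightarrow> P \<in> NC (n - j)"
proof -
  have disj: "W \<inter> {p..<p + j} = {}" if "W \<in> (`) (skip p j) ` P" for W
    using that skip_range[of p j] by auto
  have "partition_on {..<n} (insert {p..<p + j} ((`) (skip p j) ` P)) \<longleftrightarrow>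
      partition_on (skip p j ` {..<n - j}) ((`) (skip p j) ` P)"
    using disj assms by (subst partition_on_insert) (auto simp: disjnt_def skip_image_lessThan)
  then show ?thesis
    using noncrossing_insert_interval[of "(`) (skip p j) ` P" p "p + j"] disj
    by (simp add: NC_def partition_on_inj_image_iff skip_inj
        noncrossing_strict_mono_image skip_strict_mono)
qed

text \<open>
  Deleting the interval block and closing the gap loses no information.
\<close>

lemma NC_ending_bij:
  assumes j: "1 \<le> j" "p + j \<le> n"
  shows "bij_betw (\<lambda>P. insert {p..<p + j} ((`) (skip p j) ` P))
           (NC_reaching p (n - j)) (NC_ending p j n)"
    (is "bij_betw ?h _ _")
proof -
  have notin: "{p..<p + j} \<notin> (`) (skip p j) ` P" for P
  proof
    assume "{p..<p + j} \<in> (`) (skip p j) ` P"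
    then have "p \<in> range (skip p j)" using j by fastforce
    with j show False by (auto simp: skip_range)
  qed
  have mem: "?h P \<in> NC_ending p j n \<longleftrightarrow> P \<in> NC_reaching p (n - j)" for P
    using notin[of P]
    by (auto simp: NC_ending_def NC_reaching_def insert_interval_NC_iff[OF j] skip_less_iff)
  have inj: "inj_on ?h (NC_reaching p (n - j))"
  proof (rule inj_onI)
    fix P Q assume "?h P = ?h Q"
    with notin have "(`) (skip p j) ` P = (`) (skip p j) ` Q"
      by (metis insert_ident)
    then show "P = Q"
      by (simp add: inj_image_eq_iff[OF inj_image_set[OF skip_inj]])
  qed
  have "P \<in> ?h ` NC_reaching p (n - j)" if P: "P \<in> NC_ending p j n" for P
  proof -
    let ?Q = "vimage (skip p j) ` (P - {{p..<p + j}})"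
    have "skip p j ` (skip p j -` V) = V" if "V \<in> P - {{p..<p + j}}" for V
    proof -
      have "V \<inter> {p..<p + j} = {}"
        using P that by (auto simp: NC_ending_def NC_def partition_on_def disjoint_def)
      then show ?thesis by (simp add: image_vimage_eq skip_range) blast
    qed
    then have "(`) (skip p j) ` ?Q = P - {{p..<p + j}}"
      by (simp add: image_image)
    then have "?h ?Q = P" using P by (auto simp: NC_ending_def)
    with P mem show ?thesis by (metis image_eqI)
  qed
  with mem inj show ?thesis by (auto simp: bij_betw_def)
qed

lemma sum_NC_ending:
  assumes j: "1 \<le> j" "p + j \<le> n"
  shows "(\<Sum>P\<in>NC_ending p j n. \<Prod>V\<in>P. \<kappa> (card V)) = \<kappa> j * nc_weight \<kappa> p (n - j)"
proof -
  have "(\<Prod>V\<in>insert {p..<p + j} ((`) (skip p j) ` P). \<kappa> (card V)) =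
      \<kappa> j * (\<Prod>V\<in>P. \<kappa> (card V))" if "P \<in> NC_reaching p (n - j)" for P
  proof -
    have "finite P"
      using that by (auto simp: NC_reaching_def NC_def intro: finite_elements)
    moreover have "{p..<p + j} \<notin> (`) (skip p j) ` P"
    proof
      assume "{p..<p + j} \<in> (`) (skip p j) ` P"
      then have "p \<in> range (skip p j)" using j by fastforce
      with j show False by (auto simp: skip_range)
    qed
    ultimately show ?thesis
      by (simp add: prod.reindex[OF inj_image_set[OF skip_inj]] card_image
          inj_on_subset[OF skip_inj])
  qed
  then show ?thesis
    unfolding sum.reindex_bij_betw[OF NC_ending_bij[OF j], symmetric]
    by (simp add: nc_weight_def sum_distrib_left)
qed

text \<open>
  A partition that reaches below \<open>p + 1\<close> but not below \<open>p\<close> has a block \<open>V\<close> with minimum \<open>p\<close>, and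
  all its other blocks reach below \<open>p\<close>. Such a block would cross \<open>V\<close> if it had a point between two
  points of \<open>V\<close>; hence \<open>V\<close> has no gaps.
\<close>

lemma NC_reaching_Suc:
  assumes "p < n"
  shows "NC_reaching (Suc p) n = NC_reaching p n \<union> (\<Union>j\<in>{1..n - p}. NC_ending p j n)"
proof (intro equalityI subsetI)
  fix P assume P: "P \<in> NC_reaching (Suc p) n"
  show "P \<in> NC_reaching p n \<union> (\<Union>j\<in>{1..n - p}. NC_ending p j n)"
  proof (cases "P \<in> NC_reaching p n")
    case False
    have part: "partition_on {..<n} P" and nc: "noncrossing P"
      and reach: "\<And>V. V \<in> P \<Longrightarrow> \<exists>x\<in>V. x < Suc p"
      using P by (auto simp: NC_reaching_def NC_def)
    have uniq: "V = W" if "V \<in> P" "W \<in> P" "x \<in> V" "x \<in> W" for V W x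
      using part that by (auto simp: partition_on_def disjoint_def)
    obtain V where V: "V \<in> P" "\<And>x. x \<in> V \<Longrightarrow> p \<le> x"
      using False P by (auto simp: NC_reaching_def not_less)
    then have pV: "p \<in> V" using reach[of V] by (auto simp: less_Suc_eq_le dest: antisym)
    have other: "\<exists>x\<in>W. x < p" if "W \<in> P" "W \<noteq> V" for W
      using reach[of W] that uniq[OF _ V(1) _ pV] by (auto simp: less_Suc_eq)
    have sub: "V \<subseteq> {..<n}" using part V(1) by (auto simp: partition_on_def)
    then have fin: "finite V" by (rule finite_subset) simp
    have fill: "y \<in> V" if y: "p \<le> y" "y \<le> Max V" for y
    proof (rule ccontr)
      assume "y \<notin> V"
      have max: "Max V \<in> V" using fin pV by (intro Max_in) auto
      with sub y have "y \<in> \<Union>P" using part by (auto simp: partition_on_def)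
      then obtain W where W: "W \<in> P" "y \<in> W" by blast
      with \<open>y \<notin> V\<close> have "W \<noteq> V" by blast
      then obtain z where z: "z \<in> W" "z < p" using other W by blast
      \<comment> \<open>Now \<open>z < p < y < Max V\<close>, with \<open>z, y\<close> in \<open>W\<close> and \<open>p, Max V\<close> in \<open>V\<close>.\<close>
      have "p < y" "y < Max V" using y \<open>y \<notin> V\<close> pV max by (auto simp: le_less)
      with z W V(1) pV max \<open>W \<noteq> V\<close> nc show False unfolding noncrossing_def by blast
    qed
    have "V = {p..Max V}"
    proof (intro equalityI subsetI)
      show "x \<in> {p..Max V}" if "x \<in> V" for x using V(2) Max_ge[OF fin] that by simp
      show "x \<in> V" if "x \<in> {p..Max V}" for x using that by (intro fill) simp_all
    qed
    moreover have "p \<le> Max V" using fin pV by simp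
    ultimately have Veq: "V = {p..<p + (Suc (Max V) - p)}"
      by (simp add: atLeastLessThanSuc_atLeastAtMost)
    have "Suc (Max V) - p \<in> {1..n - p}"
    proof -
      have "p \<le> Max V" using fin pV by simp
      moreover have "Max V \<in> V" using fin pV by (intro Max_in) auto
      with sub have "Max V < n" by blast
      ultimately show ?thesis by auto
    qed
    moreover have "P \<in> NC_ending p (Suc (Max V) - p) n"
      using P V(1) other by (simp add: NC_ending_def NC_reaching_def flip: Veq)
    ultimately show ?thesis by blast
  qed simp
next
  fix P assume P: "P \<in> NC_reaching p n \<union> (\<Union>j\<in>{1..n - p}. NC_ending p j n)"
  show "P \<in> NC_reaching (Suc p) n"
  proof (cases "P \<in> NC_reaching p n")
    case True
    then show ?thesis by (auto simp: NC_reaching_def intro: less_SucI)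
  next
    case False
    with P obtain j where j: "j \<in> {1..n - p}" "P \<in> NC_ending p j n" by blast
    have "\<exists>x\<in>V. x < Suc p" if "V \<in> P" for V
    proof (cases "V = {p..<p + j}")
      case True
      with j show ?thesis by (intro bexI[of _ p]) auto
    next
      case False
      with j that have "\<exists>x\<in>V. x < p" by (simp add: NC_ending_def)
      then show ?thesis by (blast intro: less_SucI)
    qed
    with j show ?thesis by (auto simp: NC_reaching_def NC_ending_def)
  qed
qed

text \<open>
  Read as \<open>F(p + 1, q) = F(p, q + 1) + \<Sum>\<^sub>j \<kappa>\<^sub>j F(p, q + 1 - j)\<close> for the weight \<open>F(p, q)\<close> of
  \<open>p + q\<close> positions, this is the recursion that the coefficients of the inverse of
  \<open>1 + C(w) - w a\<close> satisfy.
\<close>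

lemma nc_weight_Suc:
  assumes "p < n"
  shows "nc_weight \<kappa> (Suc p) n = nc_weight \<kappa> p n + (\<Sum>j=1..n - p. \<kappa> j * nc_weight \<kappa> p (n - j))"
proof -
  let ?f = "\<lambda>P. \<Prod>V\<in>P. \<kappa> (card V)"
  have fin: "finite (NC_reaching p n)" "finite (NC_ending p j n)" for j
    by (auto simp: NC_reaching_def NC_ending_def intro: finite_subset[OF _ finite_NC[of n]])
  have disj: "NC_reaching p n \<inter> (\<Union>j\<in>{1..n - p}. NC_ending p j n) = {}"
    by (force simp: NC_reaching_def NC_ending_def)
  have disj2: "NC_ending p i n \<inter> NC_ending p j n = {}"
    if "i \<in> {1..n - p}" "j \<in> {1..n - p}" "i \<noteq> j" for i j
  proof -
    have False if P: "P \<in> NC_ending p i n" "P \<in> NC_ending p j n" for P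
    proof -
      have "disjoint P" "{p..<p + i} \<in> P" "{p..<p + j} \<in> P"
        using P by (auto simp: NC_ending_def NC_def partition_on_def)
      moreover have "p \<in> {p..<p + i} \<inter> {p..<p + j}"
        using \<open>i \<in> _\<close> \<open>j \<in> _\<close> by auto
      ultimately have "{p..<p + i} = {p..<p + j}" unfolding disjoint_def by blast
      then have "card {p..<p + i} = card {p..<p + j}" by simp
      with \<open>i \<noteq> j\<close> show False by simp
    qed
    then show ?thesis by blast
  qed
  have "nc_weight \<kappa> (Suc p) n = nc_weight \<kappa> p n + sum ?f (\<Union>j\<in>{1..n - p}. NC_ending p j n)"
    unfolding nc_weight_def NC_reaching_Suc[OF assms]
    by (rule sum.union_disjoint) (use fin disj in blast)+
  also have "sum ?f (\<Union>j\<in>{1..n - p}. NC_ending p j n) = (\<Sum>j=1..n - p. sum ?f (NC_ending p j n))"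
    by (rule sum.UNION_disjoint) (use fin disj2 in blast)+
  also have "(\<Sum>j=1..n - p. sum ?f (NC_ending p j n)) =
      (\<Sum>j=1..n - p. \<kappa> j * nc_weight \<kappa> p (n - j))"
    by (intro sum.cong refl sum_NC_ending) (use assms in auto)
  finally show ?thesis .
qed

lemma nc_weight_0: "nc_weight \<kappa> 0 n = (if n = 0 then 1 else 0)"
proof -
  have "NC_reaching 0 n = (if n = 0 then {{}} else {})"
    by (auto simp: NC_reaching_def NC_def partition_on_def noncrossing_def)
  then show ?thesis by (simp add: nc_weight_def)
qed

lemma nths_replicate: "nths (replicate n a) V = replicate (card (V \<inter> {..<n})) a"
proof -
  have "set (nths (replicate n a) V) \<subseteq> {a}" using set_nths_subset[of "replicate n a" V] by auto
  moreover have "length (nths (replicate n a) V) = card (V \<inter> {..<n})"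
    by (simp add: length_nths) (rule arg_cong[of _ _ card], auto)
  ultimately show ?thesis by (metis replicate_eqI singletonD subsetD)
qed

text \<open>
  With equal arguments a cumulant depends on a block only through its cardinality, so the
  moment-cumulant formula becomes a weighted count of partitions.
\<close>

lemma moment_nc_weight:
  assumes "\<phi> 1 = 1"
  shows "\<phi> (a ^ n) = nc_weight (\<lambda>m. free_cumulant \<phi> (replicate m a)) n n"
proof (cases "n = 0")
  case True
  then show ?thesis by (simp add: nc_weight_0 assms)
next
  case False
  have reach: "NC_reaching n n = NC n"
  proof -
    have "\<exists>x\<in>V. x < n" if "P \<in> NC n" "V \<in> P" for P V
    proof -
      have "V \<noteq> {}" "V \<subseteq> {..<n}" using that by (auto simp: NC_def partition_on_def)
      then show ?thesis by blast
    qed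
    then show ?thesis by (auto simp: NC_reaching_def)
  qed
  have "\<phi> (a ^ n) = \<phi> (prod_list (replicate n a))" by (simp add: prod_list_replicate)
  also have "\<dots> = (\<Sum>P\<in>NC n. \<Prod>V\<in>P. free_cumulant \<phi> (nths (replicate n a) V))"
    using False by (subst moment_cumulant) auto
  also have "\<dots> = (\<Sum>P\<in>NC n. \<Prod>V\<in>P. free_cumulant \<phi> (replicate (card V) a))"
  proof (intro sum.cong prod.cong refl)
    fix P V assume "P \<in> NC n" "V \<in> P"
    then have "V \<inter> {..<n} = V" by (auto simp: NC_def partition_on_def)
    then show "free_cumulant \<phi> (nths (replicate n a) V) = free_cumulant \<phi> (replicate (card V) a)"
      by (simp add: nths_replicate)
  qed
  finally show ?thesis by (simp add: nc_weight_def reach)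
qed

section \<open>Centred words and generated subalgebras\<close>

context star_probability_space
begin

lemma phi_add: "\<phi> (a + b) = \<phi> a + \<phi> b"
  and phi_scale: "\<phi> (smul c a) = c * \<phi> a"
  and phi_diff: "\<phi> (a - b) = \<phi> a - \<phi> b"
  and phi_zero: "\<phi> 0 = 0"
  and phi_sum: "\<phi> (sum f S) = (\<Sum>x\<in>S. \<phi> (f x))"
proof -
  interpret L: Vector_Spaces.linear smul "(*)" \<phi> by (rule state_linear)
  show "\<phi> (a + b) = \<phi> a + \<phi> b" by (rule L.add)
  show "\<phi> (smul c a) = c * \<phi> a" by (rule L.scale)
  show "\<phi> (a - b) = \<phi> a - \<phi> b" by (rule L.diff)
  show "\<phi> 0 = 0" by (rule L.zero)
  show "\<phi> (sum f S) = (\<Sum>x\<in>S. \<phi> (f x))" by (rule L.sum)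
qed

lemma star_sum: "star (sum f S) = (\<Sum>x\<in>S. star (f x))"
proof -
  have zero: "star 0 = 0" using star_add[of 0 0] by simp
  show ?thesis
    by (induction S rule: infinite_finite_induct) (auto simp: zero star_add)
qed

definition centred :: "'a \<Rightarrow> 'a" where
  "centred a = a - smul (\<phi> a) 1"

lemma phi_centred: "\<phi> (centred a) = 0"
  by (simp add: centred_def phi_diff phi_scale state_one)

lemma centred_split: "a = centred a + smul (\<phi> a) 1"
  by (simp add: centred_def)

lemma centred_mult_split: "a * b = centred a * b + smul (\<phi> a) b"
  using scale_mult_left[of "\<phi> a" 1 b] by (simp add: centred_def algebra_simps)

lemma unital_subalgebraD:
  assumes "unital_subalgebra smul S"
  shows "subspace S" "1 \<in> S" "\<And>a b. a \<in> S \<Longrightarrow> b \<in> S \<Longrightarrow> a * b \<in> S"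
    "\<And>a. a \<in> S \<Longrightarrow> centred a \<in> S"
  using assms
  by (auto simp: unital_subalgebra_def centred_def intro!: subspace_diff subspace_scale)

lemma generated_subalgebra: "unital_subalgebra smul (generated_subalgebra smul X)"
  unfolding generated_subalgebra_def
  by (rule hull_in) (auto simp: unital_subalgebra_def intro!: subspace_Inter)

lemma generated_subalgebra_superset: "X \<subseteq> generated_subalgebra smul X"
  unfolding generated_subalgebra_def by (rule hull_subset)

lemma generated_subalgebra_least:
  "X \<subseteq> S \<Longrightarrow> unital_subalgebra smul S \<Longrightarrow> generated_subalgebra smul X \<subseteq> S"
  unfolding generated_subalgebra_def by (rule hull_minimal)

lemma generated_subalgebra_mono:
  "X \<subseteq> Y \<Longrightarrow> generated_subalgebra smul X \<subseteq> generated_subalgebra smul Y"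
  unfolding generated_subalgebra_def by (rule hull_mono)

text \<open>
  The hypothesis on words in the definition of free independence, as a predicate that splits
  along concatenation.
\<close>

definition centred_word :: "('i \<Rightarrow> 'a set) \<Rightarrow> 'i list \<Rightarrow> 'a list \<Rightarrow> bool" where
  "centred_word A js as \<longleftrightarrow>
     distinct_adj js \<and> list_all2 (\<lambda>j a. a \<in> A j \<and> \<phi> a = 0) js as"

lemma free_subalgebrasD:
  assumes "free_subalgebras \<phi> J A" "centred_word A js as" "js \<noteq> []" "set js \<subseteq> J"
  shows "\<phi> (prod_list as) = 0"
  using assms unfolding free_subalgebras_def centred_word_def by blast

lemma free_subalgebrasI:
  assumes "\<And>js as. centred_word A js as \<Longrightarrow> js \<noteq> [] \<Longrightarrow> set js \<subseteq> J \<Longrightarrow> \<phi> (prod_list as) = 0"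
  shows "free_subalgebras \<phi> J A"
  using assms unfolding free_subalgebras_def centred_word_def by blast

lemma centred_word_append:
  "centred_word A (js @ ks) (as @ bs) \<longleftrightarrow>
     centred_word A js as \<and> centred_word A ks bs \<and>
     (js = [] \<or> ks = [] \<or> last js \<noteq> hd ks)"
  if "length js = length as"
  using that unfolding centred_word_def distinct_adj_def successively_append_iff
  by (auto simp: list_all2_append)

lemma centred_word_singleton: "centred_word A [j] [a] \<longleftrightarrow> a \<in> A j \<and> \<phi> a = 0"
  by (simp add: centred_word_def)

lemma centred_word_Nil: "centred_word A [] []"
  by (simp add: centred_word_def)

lemma centred_word_length: "centred_word A js as \<Longrightarrow> length js = length as"
  by (auto simp: centred_word_def list_all2_lengthD)

lemma centred_word_snoc:
  "centred_word A (js @ [j]) (as @ [a]) \<longleftrightarrow>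
     centred_word A js as \<and> a \<in> A j \<and> \<phi> a = 0 \<and> (js = [] \<or> last js \<noteq> j)"
  if "length js = length as"
  using centred_word_append[OF that, of A "[j]" "[a]"] by (auto simp: centred_word_singleton)

lemma centred_word_Cons:
  "centred_word A (j # js) (a # as) \<longleftrightarrow>
     a \<in> A j \<and> \<phi> a = 0 \<and> centred_word A js as \<and> (js = [] \<or> hd js \<noteq> j)"
  by (auto simp: centred_word_def distinct_adj_Cons)

lemma free_subalgebras_mono:
  assumes "free_subalgebras \<phi> J A" "K \<subseteq> J" "\<And>j. j \<in> K \<Longrightarrow> B j \<subseteq> A j"
  shows "free_subalgebras \<phi> K B"
proof (rule free_subalgebrasI)
  fix js as assume w: "centred_word B js as" "js \<noteq> []" "set js \<subseteq> K"
  have "list_all2 (\<lambda>j a. a \<in> A j \<and> \<phi> a = 0) js as"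
    using w assms(3) unfolding centred_word_def list_all2_conv_all_nth
    by (meson nth_mem subsetD)
  with w have "centred_word A js as" by (simp add: centred_word_def)
  with w assms(2) show "\<phi> (prod_list as) = 0" by (intro free_subalgebrasD[OF assms(1)]) auto
qed

lemma prod_list_mem:
  assumes "unital_subalgebra smul S" "set as \<subseteq> S"
  shows "prod_list as \<in> S"
  using assms(2) by (induction as) (auto intro: unital_subalgebraD[OF assms(1)])

lemma centred_word_mem:
  assumes "centred_word B js as" "\<And>j. j \<in> set js \<Longrightarrow> B j \<subseteq> S"
  shows "set as \<subseteq> S"
proof -
  have "as ! n \<in> S" if "n < length as" for n
    using assms that unfolding centred_word_def list_all2_conv_all_nth
    by (metis nth_mem subsetD)
  then show ?thesis by (auto simp: in_set_conv_nth)
qed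

section \<open>Associativity of free independence\<close>

text \<open>
  Cut an alternating word over the pairs into maximal runs with constant first index. Each run
  alternates in the second index, so freeness inside \<open>A i\<close> makes its product a centred element of
  \<open>A i\<close>; the runs then form an alternating word over the first index.
\<close>

lemma free_subalgebras_refine:
  assumes free: "free_subalgebras \<phi> I A"
    and alg: "\<And>i. i \<in> I \<Longrightarrow> unital_subalgebra smul (A i)"
    and inner: "\<And>i. i \<in> I \<Longrightarrow> free_subalgebras \<phi> J (B i)"
    and sub: "\<And>i j. i \<in> I \<Longrightarrow> j \<in> J \<Longrightarrow> B i j \<subseteq> A i"
  shows "free_subalgebras \<phi> (I \<times> J) (\<lambda>(i, j). B i j)"
proof (rule free_subalgebrasI)
  \<comment> \<open>Reading from the left: the word \<open>as\<close> of completed runs, the current run \<open>ys\<close> in \<open>A i\<close>,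
    and the unread letters \<open>zs\<close>.\<close>
  have run: "\<phi> (prod_list as * prod_list ys * prod_list zs) = 0"
    if "centred_word (\<lambda>(i, j). B i j) ps zs" "set ps \<subseteq> I \<times> J"
      and "centred_word A us as" "set us \<subseteq> I" "us = [] \<or> last us \<noteq> i" "i \<in> I"
      and "centred_word (B i) js ys" "js \<noteq> []" "set js \<subseteq> J"
      and "ps = [] \<or> hd ps \<noteq> (i, last js)"
    for ps zs us as i js ys
    using that
  proof (induction ps arbitrary: zs us as i js ys)
    case Nil
    then have "zs = []" by (simp add: centred_word_def)
    have y0: "\<phi> (prod_list ys) = 0"
      using Nil by (intro free_subalgebrasD[OF inner]) auto
    have yA: "prod_list ys \<in> A i"
      using Nil
      by (intro prod_list_mem alg centred_word_mem[where B="B i" and js=js] sub) auto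
    have "centred_word A (us @ [i]) (as @ [prod_list ys])"
      using Nil y0 yA by (subst centred_word_snoc) (auto dest: centred_word_length)
    then have "\<phi> (prod_list (as @ [prod_list ys])) = 0"
      using Nil by (intro free_subalgebrasD[OF free, of "us @ [i]"]) auto
    with \<open>zs = []\<close> show ?case by simp
  next
    case (Cons p ps)
    obtain k j where p: "p = (k, j)" by fastforce
    from Cons.prems(1) obtain z zs' where zs: "zs = z # zs'"
      by (auto simp: centred_word_def list_all2_Cons1)
    have z: "z \<in> B k j" "\<phi> z = 0" "centred_word (\<lambda>(i, j). B i j) ps zs'"
      "ps = [] \<or> hd ps \<noteq> (k, j)"
      using Cons.prems(1) by (auto simp: zs p centred_word_Cons)
    show ?case
    proof (cases "k = i")
      case True
      have "centred_word (B i) (js @ [j]) (ys @ [z])"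
        using Cons.prems z True by (subst centred_word_snoc) (auto simp: p dest: centred_word_length)
      then have "\<phi> (prod_list as * prod_list (ys @ [z]) * prod_list zs') = 0"
        using Cons.prems z True
        by (intro Cons.IH[of zs' us as i "js @ [j]" "ys @ [z]"]) (auto simp: p)
      then show ?thesis by (simp add: zs mult.assoc)
    next
      case False
      have y0: "\<phi> (prod_list ys) = 0"
        using Cons.prems by (intro free_subalgebrasD[OF inner]) auto
      have yA: "prod_list ys \<in> A i"
        using Cons.prems
        by (intro prod_list_mem alg centred_word_mem[where B="B i" and js=js] sub) auto
      have "centred_word A (us @ [i]) (as @ [prod_list ys])"
        using Cons.prems y0 yA by (subst centred_word_snoc) (auto dest: centred_word_length)
      then have "\<phi> (prod_list (as @ [prod_list ys]) * prod_list [z] * prod_list zs') = 0"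
        using Cons.prems z False
        by (intro Cons.IH[of zs' "us @ [i]" "as @ [prod_list ys]" k "[j]" "[z]"])
          (auto simp: p centred_word_singleton)
      then show ?thesis by (simp add: zs mult.assoc)
    qed
  qed
  fix ps zs
  assume w: "centred_word (\<lambda>(i, j). B i j) ps zs" "ps \<noteq> []" "set ps \<subseteq> I \<times> J"
  then obtain p ps' where ps: "ps = p # ps'" by (cases ps) auto
  obtain i j where p: "p = (i, j)" by fastforce
  from w(1) obtain z zs' where zs: "zs = z # zs'"
    by (auto simp: ps centred_word_def list_all2_Cons1)
  have "\<phi> (prod_list [] * prod_list [z] * prod_list zs') = 0"
    using w by (intro run[of ps' zs' "[]" "[]" i "[j]" "[z]"])
      (auto simp: ps p zs centred_word_Cons centred_word_Nil)
  then show "\<phi> (prod_list zs) = 0" by (simp add: zs)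
qed

definition word_products :: "('i \<Rightarrow> 'a set) \<Rightarrow> 'i set \<Rightarrow> 'a set" where
  "word_products A X =
     {prod_list as | js as. centred_word A js as \<and> js \<noteq> [] \<and> set js \<subseteq> X}"

lemma phi_word_span:
  assumes "free_subalgebras \<phi> X A" "y \<in> span (word_products A X)"
  shows "\<phi> y = 0"
  using assms(2)
proof (induction rule: span_induct_alt)
  case base
  show ?case by (rule phi_zero)
next
  case (step c x y)
  have "\<phi> x = 0" using step assms(1) by (auto simp: word_products_def intro: free_subalgebrasD)
  with step show ?case by (simp add: phi_add phi_scale)
qed

text \<open>
  If the word starts in another algebra, centre \<open>a\<close>: its centred part extends the word, its scalar
  part leaves it as it is. If the word starts in the same algebra, multiply \<open>a\<close> into the first
  letter and centre the product.
\<close>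

lemma letter_mult_word_span:
  assumes alg: "\<And>x. x \<in> X \<Longrightarrow> unital_subalgebra smul (A x)"
    and x: "x \<in> X" and a: "a \<in> A x"
    and y: "y \<in> span (insert 1 (word_products A X))"
  shows "a * y \<in> span (insert 1 (word_products A X))" (is "_ \<in> span ?W")
  using y
proof (induction rule: span_induct_alt)
  case base
  show ?case by (simp add: span_zero)
next
  case (step c w y)
  have letter: "centred b \<in> span ?W" if "b \<in> A x" for b
    unfolding word_products_def
    by (intro span_base insertI2 CollectI exI[of _ "[x]"] exI[of _ "[centred b]"])
      (use that x unital_subalgebraD[OF alg[OF x]] in \<open>simp add: centred_word_singleton phi_centred\<close>)
  have "a * w \<in> span ?W"
  proof (cases "w = 1")
    case True
    have "centred a + smul (\<phi> a) 1 \<in> span ?W"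
      by (intro span_add span_scale letter a span_base) simp
    with True show ?thesis by (simp flip: centred_split)
  next
    case False
    with step obtain js as where w: "w = prod_list as" "centred_word A js as" "js \<noteq> []"
      "set js \<subseteq> X" by (auto simp: word_products_def)
    then obtain j js' b as' where js: "js = j # js'" "as = b # as'"
      by (cases js) (auto simp: centred_word_def list_all2_Cons1)
    have w_in: "w \<in> span ?W" by (rule span_base) (use step in simp)
    have tail: "prod_list as' \<in> span ?W"
    proof (cases "js' = []")
      case True
      with w js have "as' = []" by (simp add: centred_word_def)
      then show ?thesis by (simp add: span_base)
    next
      case False
      with w js show ?thesis
        by (intro span_base) (auto simp: word_products_def centred_word_Cons)
    qed
    show ?thesis
    proof (cases "j = x")
      case True
      have ab: "a * b \<in> A x"
        using w js True a by (auto simp: centred_word_Cons intro: unital_subalgebraD[OF alg[OF x]])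
      have "centred_word A (x # js') (centred (a * b) # as')"
        using w js True ab unital_subalgebraD[OF alg[OF x]]
        by (auto simp: centred_word_Cons phi_centred)
      then have "prod_list (centred (a * b) # as') \<in> span ?W"
        unfolding word_products_def using w js x by (intro span_base insertI2 CollectI) fastforce
      moreover have "a * w = centred (a * b) * prod_list as' + smul (\<phi> (a * b)) (prod_list as')"
        using centred_mult_split[of "a * b" "prod_list as'"] by (simp add: w js mult.assoc)
      ultimately show ?thesis by (simp add: span_add span_scale tail)
    next
      case False
      have "centred_word A (x # js) (centred a # as)"
        using w js False a unital_subalgebraD[OF alg[OF x]]
        by (auto simp: centred_word_Cons phi_centred)
      then have "prod_list (centred a # as) \<in> span ?W"
        unfolding word_products_def using w js x by (intro span_base insertI2 CollectI) fastforce
      then show ?thesis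
        using centred_mult_split[of a w] by (simp add: w span_add span_scale w_in[unfolded w])
    qed
  qed
  with step show ?case
    by (simp add: distrib_left scale_mult_right span_add span_scale)
qed

text \<open>
  Products of letters reduce to a scalar plus combinations of centred words. The left
  multipliers of that span form a unital subalgebra, so it is enough to multiply by single letters.
\<close>

lemma generated_subalgebra_word_span:
  assumes alg: "\<And>x. x \<in> X \<Longrightarrow> unital_subalgebra smul (A x)"
  shows "generated_subalgebra smul (\<Union>x\<in>X. A x) \<subseteq> span (insert 1 (word_products A X))"
    (is "_ \<subseteq> span ?W")
proof -
  let ?S = "{b. \<forall>y\<in>span ?W. b * y \<in> span ?W}"
  have "unital_subalgebra smul ?S"
    unfolding unital_subalgebra_def subspace_def
    by (auto simp: distrib_right scale_mult_left mult.assoc span_add span_scale span_zero)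
  then have "generated_subalgebra smul (\<Union>x\<in>X. A x) \<subseteq> ?S"
    by (rule generated_subalgebra_least[rotated]) (auto intro: letter_mult_word_span alg)
  moreover have "1 \<in> span ?W" by (simp add: span_base)
  ultimately show ?thesis by fastforce
qed

text \<open>
  The value \<open>j\<close> of \<open>g\<close> is the colour of a letter. A centred element of the algebra of one colour
  is a combination of nonempty centred words with letters of that colour. In an alternating product
  of such elements neighbouring words differ in colour, so their concatenation is a centred word of the original family.
\<close>

lemma free_subalgebras_group:
  assumes free: "free_subalgebras \<phi> X A"
    and alg: "\<And>x. x \<in> X \<Longrightarrow> unital_subalgebra smul (A x)"
  shows "free_subalgebras \<phi> J (\<lambda>j. generated_subalgebra smul (\<Union>x\<in>{x\<in>X. g x = j}. A x))"
proof (rule free_subalgebrasI)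
  let ?B = "\<lambda>j. generated_subalgebra smul (\<Union>x\<in>{x\<in>X. g x = j}. A x)"
  let ?W = "\<lambda>j. word_products A {x\<in>X. g x = j}"
  have centre: "b \<in> span (?W j)" if b: "b \<in> ?B j" "\<phi> b = 0" for b j
  proof -
    have "b \<in> span (insert 1 (?W j))"
      using generated_subalgebra_word_span[of "{x\<in>X. g x = j}" A] alg b by auto
    then obtain c where c: "b - smul c 1 \<in> span (?W j)" by (auto simp: span_breakdown_eq)
    moreover have "free_subalgebras \<phi> {x\<in>X. g x = j} A"
      using free by (rule free_subalgebras_mono) auto
    ultimately have "\<phi> (b - smul c 1) = 0" by (blast intro: phi_word_span)
    with b have "c = 0" by (simp add: phi_diff phi_scale state_one)
    with c show ?thesis by simp
  qed
  \<comment> \<open>The factors \<open>bs\<close> are expanded one after the other; \<open>as\<close> is the concatenation of the words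
    chosen so far.\<close>
  have expand: "\<phi> (prod_list as * prod_list bs) = 0"
    if "centred_word ?B js bs" and "centred_word A xs as" and "set xs \<subseteq> X"
      and "xs = [] \<or> js = [] \<or> g (last xs) \<noteq> hd js" and "xs \<noteq> [] \<or> js \<noteq> []"
    for js bs xs as
    using that
  proof (induction js arbitrary: bs xs as)
    case Nil
    then show ?case using free
      by (auto simp: centred_word_def intro!: free_subalgebrasD[OF free])
  next
    case (Cons j js)
    then obtain b bs' where bs: "bs = b # bs'" by (auto simp: centred_word_def list_all2_Cons1)
    from Cons.prems(1) have b: "b \<in> ?B j" "\<phi> b = 0" and bs': "centred_word ?B js bs'"
      "js = [] \<or> hd js \<noteq> j" by (auto simp: bs centred_word_Cons)
    have "\<phi> (prod_list as * y * prod_list bs') = 0" if "y \<in> span (?W j)" for y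
      using that
    proof (induction rule: span_induct_alt)
      case base
      show ?case by (simp add: phi_zero)
    next
      case (step c w y)
      from step(1) obtain ys cs where w: "w = prod_list cs" "centred_word A ys cs" "ys \<noteq> []"
        "set ys \<subseteq> {x\<in>X. g x = j}" by (auto simp: word_products_def)
      have ends: "g (hd ys) = j" "g (last ys) = j"
        using subsetD[OF w(4) hd_in_set[OF w(3)]] subsetD[OF w(4) last_in_set[OF w(3)]] by auto
      have "centred_word A (xs @ ys) (as @ cs)"
        using Cons.prems w ends
        by (subst centred_word_append) (auto dest: centred_word_length)
      then have "\<phi> (prod_list (as @ cs) * prod_list bs') = 0"
        using Cons.prems w ends bs'
        by (intro Cons.IH[of bs' "xs @ ys" "as @ cs"]) auto
      with step(2) show ?case
        by (simp add: w distrib_left distrib_right scale_mult_left scale_mult_right phi_add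
            phi_scale mult.assoc)
    qed
    from this[OF centre[OF b]] show ?case by (simp add: bs mult.assoc)
  qed
  fix js bs
  assume "centred_word ?B js bs" "js \<noteq> []"
  then show "\<phi> (prod_list bs) = 0"
    using expand[of js bs "[]" "[]"] by (simp add: centred_word_Nil)
qed

end

section \<open>Cumulants and power series over the algebra\<close>

lemma fps_ring_inverse:
  fixes f :: "'b::ring_1 fps"
  assumes "f $ 0 = 1"
  obtains g where "g * f = 1" "f * g = 1"
  using fps_left_inverse[of 1 f] fps_right_inverse'[of 1 f 1] assms by auto

context star_probability_space
begin

definition scalar_fps :: "complex fps \<Rightarrow> 'a fps" where
  "scalar_fps c = Abs_fps (\<lambda>n. smul (c $ n) 1)"

definition phi_fps :: "'a fps \<Rightarrow> complex fps" where
  "phi_fps X = Abs_fps (\<lambda>n. \<phi> (X $ n))"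

lemma scalar_fps_nth: "scalar_fps c $ n = smul (c $ n) 1"
  by (simp add: scalar_fps_def)

lemma phi_fps_nth: "phi_fps X $ n = \<phi> (X $ n)"
  by (simp add: phi_fps_def)

lemma smul_1_mult: "smul c 1 * a = smul c a"
  and mult_smul_1: "a * smul c 1 = smul c a"
  by (simp_all add: scale_mult_left scale_mult_right)

lemma scalar_fps_mult_nth:
  "(scalar_fps c * X) $ n = (\<Sum>i=0..n. smul (c $ i) (X $ (n - i)))"
  by (simp add: fps_mult_nth scalar_fps_nth smul_1_mult)

lemma scalar_fps_commute: "X * scalar_fps c = scalar_fps c * X"
proof (rule fps_ext)
  fix n
  have "(X * scalar_fps c) $ n = (\<Sum>i=0..n. smul (c $ (n - i)) (X $ i))"
    by (simp add: fps_mult_nth scalar_fps_nth mult_smul_1)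
  also have "\<dots> = (\<Sum>i=0..n. smul (c $ i) (X $ (n - i)))"
    by (subst sum.atLeastAtMost_rev) simp
  finally show "(X * scalar_fps c) $ n = (scalar_fps c * X) $ n"
    by (simp add: scalar_fps_mult_nth)
qed

lemma scalar_fps_diff: "scalar_fps (c - d) = scalar_fps c - scalar_fps d"
  and scalar_fps_add: "scalar_fps (c + d) = scalar_fps c + scalar_fps d"
  by (simp_all add: fps_eq_iff scalar_fps_nth scale_left_diff_distrib scale_left_distrib)

lemma phi_fps_scalar_mult: "phi_fps (scalar_fps c * X) = c * phi_fps X"
  by (rule fps_ext)
    (simp only: phi_fps_nth scalar_fps_mult_nth fps_mult_nth[of c] phi_sum phi_scale)

lemma phi_fps_diff: "phi_fps (X - Y) = phi_fps X - phi_fps Y"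
  by (simp add: fps_eq_iff phi_fps_nth phi_diff)

definition cumulant_fps :: "'a \<Rightarrow> complex fps" where
  "cumulant_fps a = Abs_fps (\<lambda>n. if n = 0 then 0 else free_cumulant \<phi> (replicate n a))"

text \<open>
  This is \<open>w (K(w) - a)\<close> for \<open>K(w) = 1/w + C(w)/w\<close>. When \<open>C\<close> is the cumulant series, \<open>C(w)/w\<close> is
  the R-transform of \<open>a\<close>; the factor \<open>w\<close> keeps all series in nonnegative powers.
\<close>

definition pencil :: "complex fps \<Rightarrow> 'a \<Rightarrow> 'a fps" where
  "pencil c a = 1 + scalar_fps c - fps_X * fps_const a"

lemma pencil_mult_nth_Suc:
  assumes "c $ 0 = 0"
  shows "(pencil c a * X) $ Suc n =
    X $ Suc n + (\<Sum>j=1..Suc n. smul (c $ j) (X $ (Suc n - j))) - a * X $ n"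
proof -
  have "(fps_X * fps_const a * X) $ Suc n = a * X $ n"
    by (simp add: mult.assoc)
  moreover have "(scalar_fps c * X) $ Suc n = (\<Sum>j=1..Suc n. smul (c $ j) (X $ (Suc n - j)))"
    unfolding scalar_fps_mult_nth
    using assms by (subst sum.atLeast_Suc_atMost) simp_all
  ultimately show ?thesis by (simp add: pencil_def ring_distribs)
qed

lemma pencil_mult_nth_0: "c $ 0 = 0 \<Longrightarrow> (pencil c a * X) $ 0 = X $ 0"
  by (simp add: pencil_def scalar_fps_nth)

lemma pencil_inverse_nth:
  assumes "c $ 0 = 0" "pencil c a * X = 1"
  shows "X $ 0 = 1"
    and "X $ Suc n = a * X $ n - (\<Sum>j=1..Suc n. smul (c $ j) (X $ (Suc n - j)))"
proof -
  show "X $ 0 = 1" using pencil_mult_nth_0[OF assms(1), of a X] assms(2) by simp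
  show "X $ Suc n = a * X $ n - (\<Sum>j=1..Suc n. smul (c $ j) (X $ (Suc n - j)))"
    using pencil_mult_nth_Suc[OF assms(1), of a X n] assms(2) by (simp add: algebra_simps)
qed

lemma pencil_inverse_mem:
  assumes "c $ 0 = 0" "pencil c a * X = 1" and S: "unital_subalgebra smul S" "a \<in> S"
  shows "X $ n \<in> S"
proof (induction n rule: less_induct)
  case (less n)
  note S' = unital_subalgebraD[OF S(1)]
  show ?case
  proof (cases n)
    case 0
    with S' show ?thesis by (simp add: pencil_inverse_nth(1)[OF assms(1,2)])
  next
    case (Suc m)
    have "X $ m \<in> S" "\<And>j. 1 \<le> j \<Longrightarrow> X $ (Suc m - j) \<in> S"
      using less Suc by auto
    then show ?thesis
      unfolding Suc pencil_inverse_nth(2)[OF assms(1,2)]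
      using S(2) S' by (intro subspace_diff subspace_sum subspace_scale S') auto
  qed
qed

text \<open>
  Both sides satisfy the same recursion in \<open>q\<close>: on the left it is the recursion for the
  coefficients of the inverse, on the right it is \<open>nc_weight_Suc\<close>. At \<open>q = 0\<close> the statement is the
  moment-cumulant formula.
\<close>

lemma phi_power_mult_pencil_inverse:
  assumes "pencil (cumulant_fps a) a * X = 1"
  shows "\<phi> (a ^ p * X $ q) = nc_weight (\<lambda>m. free_cumulant \<phi> (replicate m a)) p (p + q)"
proof (induction q arbitrary: p rule: less_induct)
  case (less q)
  let ?\<kappa> = "\<lambda>m. free_cumulant \<phi> (replicate m a)"
  have c0: "cumulant_fps a $ 0 = 0" by (simp add: cumulant_fps_def)
  show ?case
  proof (cases q)
    case 0
    then show ?thesis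
      using moment_nc_weight[of \<phi> a p, OF state_one]
      by (simp add: pencil_inverse_nth(1)[OF c0 assms])
  next
    case (Suc r)
    have "\<phi> (a ^ p * X $ Suc r) = \<phi> (a ^ Suc p * X $ r) -
        (\<Sum>j=1..Suc r. cumulant_fps a $ j * \<phi> (a ^ p * X $ (Suc r - j)))"
      unfolding pencil_inverse_nth(2)[OF c0 assms]
      by (simp add: right_diff_distrib sum_distrib_left scale_mult_right phi_diff phi_sum
          phi_scale power_Suc2 mult.assoc del: power_Suc sum.cl_ivl_Suc)
    also have "\<phi> (a ^ Suc p * X $ r) = nc_weight ?\<kappa> (Suc p) (p + Suc r)"
      using less[of r "Suc p"] Suc by simp
    also have "(\<Sum>j=1..Suc r. cumulant_fps a $ j * \<phi> (a ^ p * X $ (Suc r - j))) =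
        (\<Sum>j=1..p + Suc r - p. ?\<kappa> j * nc_weight ?\<kappa> p (p + Suc r - j))"
      using less Suc by (intro sum.cong) (auto simp: cumulant_fps_def)
    finally show ?thesis
      using nc_weight_Suc[of p "p + Suc r" ?\<kappa>] Suc by simp
  qed
qed

text \<open>
  The case \<open>p = 0\<close>: no partition of a nonempty set has all its blocks meeting the empty set.
\<close>

lemma phi_fps_pencil_inverse:
  assumes "pencil (cumulant_fps a) a * X = 1"
  shows "phi_fps X = 1"
proof (rule fps_ext)
  show "phi_fps X $ n = 1 $ n" for n
    using phi_power_mult_pencil_inverse[OF assms, of 0 n] by (simp add: phi_fps_nth nc_weight_0)
qed

lemma pencil_nth_0: "c $ 0 = 0 \<Longrightarrow> pencil c a $ 0 = 1"
  using pencil_mult_nth_0[of c a 1] by simp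

text \<open>
  For two such series \<open>C\<close>, \<open>C'\<close> with inverses \<open>Z\<close>, \<open>Y\<close>, the resolvent identity gives
  \<open>Z - Y = Z (C' - C) Y = (C' - C) Z Y\<close>. Applying \<open>\<phi>\<close> yields \<open>0 = (C' - C) \<phi>(Z Y)\<close> in the integral
  domain of complex power series, where \<open>\<phi>(Z Y)\<close> has constant coefficient \<open>1\<close>.
\<close>

lemma cumulant_fps_unique:
  assumes c: "c $ 0 = 0" and Z: "Z * pencil c a = 1" "phi_fps Z = 1"
  shows "c = cumulant_fps a"
proof -
  let ?k = "cumulant_fps a"
  have k0: "?k $ 0 = 0" by (simp add: cumulant_fps_def)
  obtain Y where Y: "Y * pencil ?k a = 1" "pencil ?k a * Y = 1"
    using fps_ring_inverse[of "pencil ?k a"] pencil_nth_0[of ?k a] k0 by auto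
  have "Z - Y = Z * (pencil ?k a - pencil c a) * Y"
    by (simp add: right_diff_distrib left_diff_distrib mult.assoc Y Z(1))
  also have "pencil ?k a - pencil c a = scalar_fps (?k - c)"
    by (simp add: pencil_def scalar_fps_diff)
  also have "Z * scalar_fps (?k - c) * Y = scalar_fps (?k - c) * (Z * Y)"
    by (simp add: scalar_fps_commute mult.assoc)
  finally have "phi_fps (Z - Y) = (?k - c) * phi_fps (Z * Y)"
    by (simp add: phi_fps_scalar_mult)
  then have "(?k - c) * phi_fps (Z * Y) = 0"
    by (simp add: phi_fps_diff Z(2) phi_fps_pencil_inverse[OF Y(2)])
  moreover have "phi_fps (Z * Y) \<noteq> 0"
  proof -
    have "pencil c a * Z = 1"
    proof -
      obtain V where V: "pencil c a * V = 1"
        using fps_ring_inverse[of "pencil c a"] pencil_nth_0[of c a] c by auto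
      have "Z = Z * (pencil c a * V)" by (simp add: V)
      then have "Z = V" by (simp add: Z(1) flip: mult.assoc)
      with V show ?thesis by simp
    qed
    then have "phi_fps (Z * Y) $ 0 = 1"
      by (simp add: phi_fps_nth pencil_inverse_nth(1)[OF c] pencil_inverse_nth(1)[OF k0 Y(2)]
          state_one)
    then show ?thesis by (metis fps_zero_nth zero_neq_one)
  qed
  ultimately show ?thesis by simp
qed

text \<open>
  Here \<open>H = (1 - E F)\<^sup>-\<^sup>1 (1 - E)\<close> stands for the sum of the alternating words \<open>E F E F \<dots>\<close> with
  signs. The recursion for \<open>H\<close> and the missing constant terms of \<open>E\<close>, \<open>F\<close> allow an induction on the
  coefficient in place of the infinite expansion; the prefix \<open>as\<close> collects the letters split off.
\<close>

lemma phi_alternating_resolvent: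
  assumes free: "free_subalgebras \<phi> UNIV D"
    and E: "\<And>n. E $ n \<in> D True" "phi_fps E = 0" "E $ 0 = 0"
    and F: "\<And>n. F $ n \<in> D False" "phi_fps F = 0" "F $ 0 = 0"
    and H: "H = 1 - E + E * F * H"
    and w: "centred_word D js as" "js = [] \<or> last js = False"
  shows "\<phi> (prod_list as * H $ n) = (if js = [] \<and> n = 0 then 1 else 0)"
  using w
proof (induction n arbitrary: js as rule: less_induct)
  case (less n)
  have E0: "\<phi> (E $ m) = 0" for m using E(2) by (metis phi_fps_nth fps_zero_nth)
  have F0: "\<phi> (F $ m) = 0" for m using F(2) by (metis phi_fps_nth fps_zero_nth)
  have wE: "centred_word D (js @ [True]) (as @ [E $ m])" for m
    using less.prems E E0 by (subst centred_word_snoc) (auto dest: centred_word_length)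
  have wEF: "centred_word D (js @ [True, False]) (as @ [E $ m, F $ l])" for m l
    using wE[of m] F F0 centred_word_snoc[of "js @ [True]" "as @ [E $ m]" D False "F $ l"]
    by (auto dest: centred_word_length)
  have "\<phi> (prod_list as * 1 $ n) = (if js = [] \<and> n = 0 then 1 else 0)"
  proof (cases "n = 0 \<and> js \<noteq> []")
    case True
    then show ?thesis using less.prems by (auto intro!: free_subalgebrasD[OF free])
  next
    case False
    then show ?thesis using less.prems by (auto simp: centred_word_def state_one phi_zero)
  qed
  moreover have "\<phi> (prod_list as * E $ n) = 0"
    using free_subalgebrasD[OF free wE[of n]] by simp
  moreover have "\<phi> (prod_list as * (E * F * H) $ n) = 0"
  proof -
    have "\<phi> (prod_list as * (E $ i * (F $ l * H $ (n - i - l)))) = 0"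
      if "i \<le> n" "l \<le> n - i" for i l
    proof (cases "i = 0")
      case True
      then show ?thesis by (simp add: E(3) phi_zero)
    next
      case False
      then have "\<phi> (prod_list (as @ [E $ i, F $ l]) * H $ (n - i - l)) = 0"
        using less.IH[of "n - i - l" "js @ [True, False]" "as @ [E $ i, F $ l]"] wEF that
        by simp
      then show ?thesis by (simp add: mult.assoc)
    qed
    then show ?thesis
      by (simp add: mult.assoc fps_mult_nth sum_distrib_left phi_sum)
  qed
  moreover have "H $ n = 1 $ n - E $ n + (E * F * H) $ n"
    by (subst H) simp
  ultimately show ?case
    by (simp add: distrib_left right_diff_distrib phi_add phi_diff)
qed

text \<open>
  The factorisation of \<open>P + Q - 1\<close> through the centred series \<open>E = 1 - P\<^sup>-\<^sup>1\<close>, \<open>F = 1 - Q\<^sup>-\<^sup>1\<close> exhibits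
  an inverse on which \<open>\<phi>\<close> is \<open>1\<close>, and uniqueness applies.
\<close>

lemma cumulant_fps_add:
  assumes free: "free_subalgebras \<phi> UNIV D"
    and alg: "\<And>t. unital_subalgebra smul (D t)"
    and a: "a \<in> D True" and b: "b \<in> D False"
  shows "cumulant_fps (a + b) = cumulant_fps a + cumulant_fps b"
proof -
  have c0: "cumulant_fps x $ 0 = 0" for x by (simp add: cumulant_fps_def)
  define P where "P = pencil (cumulant_fps a) a"
  define Q where "Q = pencil (cumulant_fps b) b"
  obtain X where X: "X * P = 1" "P * X = 1"
    using fps_ring_inverse[of P] pencil_nth_0[OF c0] unfolding P_def by metis
  obtain Y where Y: "Y * Q = 1" "Q * Y = 1"
    using fps_ring_inverse[of Q] pencil_nth_0[OF c0] unfolding Q_def by metis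
  define E where "E = 1 - X"
  define F where "F = 1 - Y"
  have X_nth: "X $ n \<in> D True" "X $ 0 = 1" for n
    using pencil_inverse_mem[OF c0 _ alg a] pencil_inverse_nth(1)[OF c0] X(2)
    unfolding P_def by metis+
  have Y_nth: "Y $ n \<in> D False" "Y $ 0 = 1" for n
    using pencil_inverse_mem[OF c0 _ alg b] pencil_inverse_nth(1)[OF c0] Y(2)
    unfolding Q_def by metis+
  have phi_one: "phi_fps 1 = 1"
    by (simp add: fps_eq_iff phi_fps_nth state_one phi_zero)
  have mem: "(1 - W) $ n \<in> D t" if "\<And>n. W $ n \<in> D t" for W n t
  proof -
    have "1 $ n \<in> D t"
      using unital_subalgebraD[OF alg[of t]] by (cases n) (auto intro: subspace_0)
    then show ?thesis
      unfolding fps_sub_nth by (intro subspace_diff unital_subalgebraD(1)[OF alg] that)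
  qed
  have E: "E $ n \<in> D True" "phi_fps E = 0" "E $ 0 = 0" for n
    using X_nth mem[of X True] phi_fps_pencil_inverse X(2)
    by (auto simp: E_def P_def phi_fps_diff phi_one)
  have F: "F $ n \<in> D False" "phi_fps F = 0" "F $ 0 = 0" for n
    using Y_nth mem[of Y False] phi_fps_pencil_inverse Y(2)
    by (auto simp: F_def Q_def phi_fps_diff phi_one)
  obtain T where T: "T * (1 - E * F) = 1" "(1 - E * F) * T = 1"
    using fps_ring_inverse[of "1 - E * F"] E(3) F(3) by auto
  define H where "H = T * (1 - E)"
  have T_eq: "T = 1 + E * F * T" using T(2) by (simp add: left_diff_distrib algebra_simps)
  have H_eq: "H = 1 - E + E * F * H"
    unfolding H_def by (subst T_eq) (simp add: distrib_right mult.assoc)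
  note res = phi_alternating_resolvent[OF free E F H_eq]
  define Z where "Z = (1 - F) * H"
  have "Z * pencil (cumulant_fps a + cumulant_fps b) (a + b) = 1"
  proof -
    have "pencil (cumulant_fps a + cumulant_fps b) (a + b) = P + Q - 1"
      by (simp add: pencil_def P_def Q_def scalar_fps_add algebra_simps flip: fps_const_add)
    also have "\<dots> = P * (1 - E * F) * Q"
    proof -
      have "1 - E * F = X + Y - X * Y" by (simp add: E_def F_def algebra_simps)
      moreover have "P * (X + Y - X * Y) * Q = (P * X) * Q + P * (Y * Q) - (P * X) * (Y * Q)"
        by (simp add: algebra_simps)
      ultimately show ?thesis by (simp add: X Y)
    qed
    also have "Z * (P * (1 - E * F) * Q) = Y * (T * ((X * P) * (1 - E * F))) * Q"
      by (simp add: Z_def H_def E_def F_def mult.assoc)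
    finally show ?thesis by (simp add: X T Y)
  qed
  moreover have "phi_fps Z = 1"
  proof (rule fps_ext)
    fix n
    have "\<phi> (F $ i * H $ (n - i)) = 0" for i
    proof -
      have "\<phi> (F $ i) = 0" using F(2) by (metis phi_fps_nth fps_zero_nth)
      then show ?thesis
        using res[of "[False]" "[F $ i]" "n - i"] F(1) by (simp add: centred_word_singleton)
    qed
    then have "\<phi> ((F * H) $ n) = 0" by (simp add: fps_mult_nth phi_sum)
    moreover have "\<phi> (H $ n) = 1 $ n"
      using res[of "[]" "[]" n] by (simp add: centred_word_Nil)
    ultimately show "phi_fps Z $ n = 1 $ n"
      by (simp add: Z_def left_diff_distrib phi_fps_nth phi_diff)
  qed
  ultimately have "cumulant_fps a + cumulant_fps b = cumulant_fps (a + b)"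
    by (intro cumulant_fps_unique) (auto simp: c0)
  then show ?thesis by simp
qed

lemma free_cumulant_sum:
  assumes fin: "finite J" "J \<noteq> {}" and free: "free_elements smul \<phi> J a" and n: "n \<ge> 1"
  shows "free_cumulant \<phi> (replicate n (\<Sum>j\<in>J. a j)) = (\<Sum>j\<in>J. free_cumulant \<phi> (replicate n (a j)))"
proof -
  let ?A = "\<lambda>j. generated_subalgebra smul {a j}"
  have "cumulant_fps (\<Sum>j\<in>J. a j) = (\<Sum>j\<in>J. cumulant_fps (a j))"
    using fin free
  proof (induction rule: finite_ne_induct)
    case (insert i J)
    let ?D = "\<lambda>t. generated_subalgebra smul (\<Union>x\<in>{x\<in>insert i J. (x = i) = t}. ?A x)"
    have sup: "a x \<in> ?D (x = i)" if "x \<in> insert i J" for x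
      using that by (intro subsetD[OF generated_subalgebra_superset])
        (auto intro!: exI[of _ x] bexI[of _ x] subsetD[OF generated_subalgebra_superset])
    have free_insert: "free_subalgebras \<phi> (insert i J) ?A"
      using insert.prems by (simp add: free_elements_def)
    then have D: "free_subalgebras \<phi> UNIV ?D"
      by (rule free_subalgebras_group) (rule generated_subalgebra)
    have "free_elements smul \<phi> J a"
      unfolding free_elements_def using free_insert by (rule free_subalgebras_mono) auto
    then have IH: "cumulant_fps (\<Sum>j\<in>J. a j) = (\<Sum>j\<in>J. cumulant_fps (a j))"
      by (rule insert.IH)
    have "(\<Sum>j\<in>J. a j) \<in> ?D False"
    proof (intro subspace_sum unital_subalgebraD(1) generated_subalgebra)
      fix x assume "x \<in> J"
      with insert.hyps sup[of x] show "a x \<in> ?D False" by (cases "x = i") auto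
    qed
    then have "cumulant_fps (a i + (\<Sum>j\<in>J. a j)) = cumulant_fps (a i) + cumulant_fps (\<Sum>j\<in>J. a j)"
      using sup[of i] by (intro cumulant_fps_add[OF D generated_subalgebra]) auto
    with insert.hyps IH show ?case by simp
  qed simp
  then have "cumulant_fps (\<Sum>j\<in>J. a j) $ n = (\<Sum>j\<in>J. cumulant_fps (a j)) $ n" by simp
  with n show ?thesis by (simp add: cumulant_fps_def fps_sum_nth)
qed

end

section \<open>The average of compactly supported distributions\<close>

lemma sets_average_measure: "sets (average_measure k \<nu>) = sets borel"
  and space_average_measure: "space (average_measure k \<nu>) = UNIV"
proof -
  have "sigma_sets UNIV (sets borel) = sets (borel :: real measure)"
    using sets.sigma_sets_eq[of "borel :: real measure"] by simp
  then show "sets (average_measure k \<nu>) = sets borel"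
    by (simp add: average_measure_def sets_measure_of_conv)
  show "space (average_measure k \<nu>) = UNIV"
    by (simp add: average_measure_def space_measure_of_conv)
qed

lemma measure_support_average_measure:
  assumes sets: "\<And>i. i \<in> {1..k} \<Longrightarrow> sets (\<nu> i) = sets borel" and k: "k \<ge> 1"
  shows "measure_support (average_measure k \<nu>) = (\<Union>i\<in>{1..k}. measure_support (\<nu> i))"
proof (intro equalityI subsetI)
  have avg: "emeasure (average_measure k \<nu>) A = (\<Sum>i=1..k. emeasure (\<nu> i) A / of_nat k)"
    if "A \<in> sets borel" for A
    by (rule emeasure_average_measure) (use sets that in auto)
  have null_iff: "emeasure (average_measure k \<nu>) U = 0 \<longleftrightarrow> (\<forall>i\<in>{1..k}. emeasure (\<nu> i) U = 0)"
    if "open U" for U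
    using that k by (simp add: avg)
  fix x
  show "x \<in> measure_support (average_measure k \<nu>)"
    if x: "x \<in> (\<Union>i\<in>{1..k}. measure_support (\<nu> i))"
  proof -
    from x obtain i where i: "i \<in> {1..k}" "x \<in> measure_support (\<nu> i)" by blast
    then show ?thesis
      unfolding measure_support_def
      by (simp add: zero_less_iff_neq_zero null_iff del: atLeastAtMost_iff) blast
  qed
  show "x \<in> (\<Union>i\<in>{1..k}. measure_support (\<nu> i))"
    if x: "x \<in> measure_support (average_measure k \<nu>)"
  proof (rule ccontr)
    assume "x \<notin> (\<Union>i\<in>{1..k}. measure_support (\<nu> i))"
    then have "\<forall>i\<in>{1..k}. \<exists>U. open U \<and> x \<in> U \<and> emeasure (\<nu> i) U = 0"
      by (auto simp: measure_support_def zero_less_iff_neq_zero)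
    then obtain U where U: "\<And>i. i \<in> {1..k} \<Longrightarrow> open (U i) \<and> x \<in> U i \<and> emeasure (\<nu> i) (U i) = 0"
      by metis
    let ?V = "\<Inter>i\<in>{1..k}. U i"
    have V: "open ?V" "x \<in> ?V" using U by auto
    have "emeasure (\<nu> i) ?V = 0" if i: "i \<in> {1..k}" for i
    proof -
      have "emeasure (\<nu> i) ?V \<le> emeasure (\<nu> i) (U i)"
        using U[OF i] sets[OF i] i by (intro emeasure_mono) auto
      with U[OF i] show ?thesis by simp
    qed
    with null_iff[OF V(1)] V x show False by (auto simp: measure_support_def)
  qed
qed

text \<open>
  The complement of the support is a union of open null sets, and by the Lindelof property
  countably many of them suffice.
\<close>

lemma AE_measure_support:
  assumes sets: "sets \<nu> = sets borel"
  shows "AE x in \<nu>. x \<in> measure_support \<nu>"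
proof -
  let ?F = "{U. open U \<and> emeasure \<nu> U = 0}"
  have compl: "- measure_support \<nu> = \<Union>?F"
    by (auto simp: measure_support_def zero_less_iff_neq_zero)
  obtain G where G: "G \<subseteq> ?F" "countable G" "\<Union>G = \<Union>?F"
    using Lindelof[of ?F] by auto
  have "\<Union>G \<in> null_sets \<nu>"
    using G sets by (intro null_sets_UN'[of G "\<lambda>U. U", simplified]) (auto simp: null_sets_def)
  then show ?thesis
    by (rule AE_I') (auto simp: G(3) simp flip: compl)
qed

lemma integrable_power_of_compact_support:
  assumes "compactly_supported_distribution \<nu>"
  shows "integrable \<nu> (\<lambda>x. x ^ n)"
proof -
  interpret real_distribution \<nu>
    using assms by (simp add: compactly_supported_distribution_def)
  have "bounded (measure_support \<nu>)"
    using assms by (auto simp: compactly_supported_distribution_def intro: compact_imp_bounded)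
  then obtain B where B: "\<And>x. x \<in> measure_support \<nu> \<Longrightarrow> \<bar>x\<bar> \<le> B"
    by (auto simp: bounded_iff)
  have "AE x in \<nu>. norm (x ^ n) \<le> B ^ n"
    using AE_measure_support[OF events_eq_borel] by eventually_elim (auto simp: power_abs B intro: power_mono)
  then show ?thesis by (intro integrable_const_bound) auto
qed

lemma nn_integral_average_measure:
  assumes sets: "\<And>i. i \<in> {1..k} \<Longrightarrow> sets (\<nu> i) = sets borel"
    and f: "f \<in> borel_measurable borel"
  shows "(\<integral>\<^sup>+x. f x \<partial>average_measure k \<nu>) = (\<Sum>i=1..k. (\<integral>\<^sup>+x. f x \<partial>\<nu> i) / of_nat k)"
proof -
  have avg: "emeasure (average_measure k \<nu>) A = (\<Sum>i=1..k. emeasure (\<nu> i) A / of_nat k)"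
    if "A \<in> sets borel" for A
    by (rule emeasure_average_measure) (use sets that in auto)
  have meas: "g \<in> borel_measurable (\<nu> i)" if "g \<in> borel_measurable borel" "i \<in> {1..k}"
    for g :: "real \<Rightarrow> ennreal" and i
    using that measurable_cong_sets[OF sets[of i] refl] by blast
  have meas': "g \<in> borel_measurable (average_measure k \<nu>)" if "g \<in> borel_measurable borel"
    for g :: "real \<Rightarrow> ennreal"
    using that measurable_cong_sets[OF sets_average_measure refl] by blast
  show ?thesis
    using f
  proof (induction rule: borel_measurable_induct)
    case (cong f g)
    then have "f = g" by auto
    with cong show ?case by simp
  next
    case (set A)
    then show ?case
      by (simp add: sets sets_average_measure avg)
  next
    case (mult u c)
    then show ?case
      by (simp add: nn_integral_cmult meas meas' sum_distrib_left ennreal_times_divide)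
  next
    case (add u v)
    then show ?case
      by (simp add: nn_integral_add meas meas' sum.distrib divide_ennreal_def distrib_right)
  next
    case (seq U)
    have inc: "incseq (\<lambda>n. \<integral>\<^sup>+x. U n x \<partial>\<nu> i)" for i
      using seq by (auto simp: incseq_def le_fun_def intro: nn_integral_mono)
    have "(\<integral>\<^sup>+x. (SUP n. U n x) \<partial>average_measure k \<nu>) =
        (SUP n. \<Sum>i=1..k. (\<integral>\<^sup>+x. U n x \<partial>\<nu> i) / of_nat k)"
      using seq by (simp add: nn_integral_monotone_convergence_SUP meas')
    also have "\<dots> = (\<Sum>i=1..k. SUP n. (\<integral>\<^sup>+x. U n x \<partial>\<nu> i) / of_nat k)"
      using inc by (intro ennreal_SUP_sum)
        (auto simp: incseq_def divide_ennreal_def intro: mult_right_mono)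
    also have "\<dots> = (\<Sum>i=1..k. (\<integral>\<^sup>+x. (SUP n. U n x) \<partial>\<nu> i) / of_nat k)"
    proof (intro sum.cong refl)
      fix i assume "i \<in> {1..k}"
      then show "(SUP n. (\<integral>\<^sup>+x. U n x \<partial>\<nu> i) / of_nat k) = (\<integral>\<^sup>+x. (SUP n. U n x) \<partial>\<nu> i) / of_nat k"
        using seq by (simp add: nn_integral_monotone_convergence_SUP meas SUP_divide_ennreal)
    qed
    finally show ?case by (simp add: SUP_apply image_comp)
  qed
qed

lemma average_measure_distribution:
  assumes \<nu>: "\<And>i. i \<in> {1..k} \<Longrightarrow> compactly_supported_distribution (\<nu> i)" and k: "k \<ge> 1"
  shows "compactly_supported_distribution (average_measure k \<nu>)"
proof -
  have real: "real_distribution (\<nu> i)" and comp: "compact (measure_support (\<nu> i))"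
    if "i \<in> {1..k}" for i
    using \<nu>[OF that] by (auto simp: compactly_supported_distribution_def)
  have sets: "sets (\<nu> i) = sets borel" and one: "emeasure (\<nu> i) UNIV = 1" if "i \<in> {1..k}" for i
  proof -
    interpret real_distribution "\<nu> i" by (rule real[OF that])
    show "sets (\<nu> i) = sets borel" by simp
    show "emeasure (\<nu> i) UNIV = 1" using emeasure_space_1 by simp
  qed
  have avg: "emeasure (average_measure k \<nu>) A = (\<Sum>i=1..k. emeasure (\<nu> i) A / of_nat k)"
    if "A \<in> sets borel" for A
    by (rule emeasure_average_measure) (use sets that in auto)
  have "emeasure (average_measure k \<nu>) (space (average_measure k \<nu>)) = 1"
    using k by (simp add: space_average_measure avg one
        ennreal_of_nat_eq_real_of_nat ennreal_times_divide flip: divide_ennreal)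
  then have "prob_space (average_measure k \<nu>)" by (rule prob_spaceI)
  then have "real_distribution (average_measure k \<nu>)"
    by (simp add: real_distribution_def real_distribution_axioms_def sets_average_measure
        space_average_measure)
  moreover have "compact (measure_support (average_measure k \<nu>))"
    using measure_support_average_measure[OF sets k] comp by auto
  ultimately show ?thesis by (simp add: compactly_supported_distribution_def)
qed

lemma moment_average_measure:
  assumes \<nu>: "\<And>i. i \<in> {1..k} \<Longrightarrow> compactly_supported_distribution (\<nu> i)" and k: "k \<ge> 1"
  shows "moment (average_measure k \<nu>) n = (\<Sum>i=1..k. moment (\<nu> i) n) / k"
proof -
  have sets: "sets (\<nu> i) = sets borel" if "i \<in> {1..k}" for i
    using \<nu>[OF that]
    by (simp add: compactly_supported_distribution_def real_distribution_def real_distribution_axioms_def)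
  have int: "integrable (\<nu> i) (\<lambda>x. x ^ n)" if "i \<in> {1..k}" for i
    using integrable_power_of_compact_support[OF \<nu>[OF that]] .
  \<comment> \<open>The cases \<open>s = 1\<close> and \<open>s = -1\<close> are the integrals of the positive and the negative part.\<close>
  have part: "enn2real (\<integral>\<^sup>+x. ennreal (s * x ^ n) \<partial>average_measure k \<nu>) =
      (\<Sum>i=1..k. enn2real (\<integral>\<^sup>+x. ennreal (s * x ^ n) \<partial>\<nu> i)) / k" for s
  proof -
    have fin: "(\<integral>\<^sup>+x. ennreal (s * x ^ n) \<partial>\<nu> i) < \<infinity>" if "i \<in> {1..k}" for i
      using integrableD(2)[OF integrable_mult_right[OF int[OF that], of s]] 
      by (simp add: top.not_eq_extremum)
    have "(\<integral>\<^sup>+x. ennreal (s * x ^ n) \<partial>average_measure k \<nu>) =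
        (\<Sum>i=1..k. (\<integral>\<^sup>+x. ennreal (s * x ^ n) \<partial>\<nu> i) / of_nat k)"
      by (subst nn_integral_average_measure) (use sets in auto)
    also have "\<dots> = (\<Sum>i=1..k. ennreal (enn2real (\<integral>\<^sup>+x. ennreal (s * x ^ n) \<partial>\<nu> i) / k))"
    proof (intro sum.cong refl)
      fix i assume "i \<in> {1..k}"
      then show "(\<integral>\<^sup>+x. ennreal (s * x ^ n) \<partial>\<nu> i) / of_nat k =
          ennreal (enn2real (\<integral>\<^sup>+x. ennreal (s * x ^ n) \<partial>\<nu> i) / k)"
        using fin[of i] k
        by (simp add: ennreal_of_nat_eq_real_of_nat flip: divide_ennreal)
    qed
    finally show ?thesis by (simp add: sum_nonneg flip: sum_divide_distrib)
  qed
  have int': "integrable (average_measure k \<nu>) (\<lambda>x. x ^ n)"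
    by (rule integrable_power_of_compact_support[OF average_measure_distribution[OF \<nu> k]])
  show ?thesis
    unfolding moment_def
    using part[of 1] part[of "-1"]
    by (simp add: real_lebesgue_integral_def[OF int'] real_lebesgue_integral_def[OF int]
        sum_subtractf diff_divide_distrib)
qed

section \<open>Sums of free compound free Poisson processes\<close>

theorem theorem3p7:
  fixes smul :: "complex \<Rightarrow> 'a::ring_1 \<Rightarrow> 'a"
    and star :: "'a \<Rightarrow> 'a"
    and \<phi> :: "'a \<Rightarrow> complex"
    and k :: nat
    and \<nu> :: "nat \<Rightarrow> real measure"
    and b :: "nat \<Rightarrow> real set \<Rightarrow> 'a"
  assumes "star_probability_space smul star \<phi>"
    and "k \<ge> 1"
    and "\<And>i. i \<in> {1..k} \<Longrightarrow> compound_free_poisson_process smul star \<phi> 1 (\<nu> i) (b i)"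
    and "free_subalgebras \<phi> {1..k}
           (\<lambda>i. generated_subalgebra smul (b i ` half_open_intervals))"
  shows "compound_free_poisson_process smul star \<phi> k (average_measure k \<nu>)
           (\<lambda>I. \<Sum>i=1..k. b i I)"
proof -
  interpret star_probability_space smul star \<phi> by (rule assms(1))
  have dist: "compactly_supported_distribution (\<nu> i)"
    and sa: "\<And>I. I \<in> half_open_intervals \<Longrightarrow> star (b i I) = b i I"
    and cum: "\<And>I n. I \<in> half_open_intervals \<Longrightarrow> n \<ge> 1 \<Longrightarrow>
      free_cumulant \<phi> (replicate n (b i I)) = of_real (measure lborel I * moment (\<nu> i) n)"
    and incr: "\<And>m I. (\<forall>j<m. I j \<in> half_open_intervals) \<Longrightarrow> disjoint_family_on I {..<m} \<Longrightarrow>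
      free_elements smul \<phi> {..<m::nat} (\<lambda>j. b i (I j))"
    if "i \<in> {1..k}" for i
    using assms(3)[OF that] unfolding compound_free_poisson_process_def self_adjoint_def by auto
  show ?thesis
    unfolding compound_free_poisson_process_def
  proof (intro conjI ballI allI impI)
    show "compactly_supported_distribution (average_measure k \<nu>)"
      using dist \<open>k \<ge> 1\<close> by (rule average_measure_distribution)
  next
    fix I assume "I \<in> half_open_intervals"
    then show "self_adjoint star (\<Sum>i=1..k. b i I)"
      unfolding self_adjoint_def star_sum by (intro sum.cong refl sa)
  next
    fix I and n :: nat assume I: "I \<in> half_open_intervals" and n: "1 \<le> n"
    have "free_elements smul \<phi> {1..k} (\<lambda>i. b i I)"
      unfolding free_elements_def
      using assms(4) by (rule free_subalgebras_mono) (use I in \<open>auto intro!: generated_subalgebra_mono\<close>)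
    then have "free_cumulant \<phi> (replicate n (\<Sum>i=1..k. b i I)) =
        (\<Sum>i=1..k. free_cumulant \<phi> (replicate n (b i I)))"
      using \<open>k \<ge> 1\<close> n by (intro free_cumulant_sum) auto
    also have "\<dots> = (\<Sum>i=1..k. of_real (measure lborel I * moment (\<nu> i) n))"
      by (intro sum.cong refl cum I n)
    also have "\<dots> = of_real (measure lborel I * (\<Sum>i=1..k. moment (\<nu> i) n))"
      by (simp only: of_real_sum sum_distrib_left)
    also have "(\<Sum>i=1..k. moment (\<nu> i) n) = real k * moment (average_measure k \<nu>) n"
      using \<open>k \<ge> 1\<close> by (subst moment_average_measure) (use dist in auto)
    also have "measure lborel I * (real k * moment (average_measure k \<nu>) n) =
        real k * measure lborel I * moment (average_measure k \<nu>) n" by simp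
    finally show "free_cumulant \<phi> (replicate n (\<Sum>i=1..k. b i I)) =
        of_real (real k * measure lborel I * moment (average_measure k \<nu>) n)" .
  next
    fix m :: nat and I :: "nat \<Rightarrow> real set"
    assume I: "(\<forall>j<m. I j \<in> half_open_intervals) \<and> disjoint_family_on I {..<m}"
    let ?A = "\<lambda>(i, j). generated_subalgebra smul {b i (I j)}"
    let ?B = "\<lambda>j. generated_subalgebra smul (\<Union>x\<in>{x\<in>{1..k} \<times> {..<m}. snd x = j}. ?A x)"
    have "free_subalgebras \<phi> ({1..k} \<times> {..<m}) ?A"
    proof (rule free_subalgebras_refine[OF assms(4) generated_subalgebra])
      fix i assume "i \<in> {1..k}"
      then show "free_subalgebras \<phi> {..<m} (\<lambda>j. generated_subalgebra smul {b i (I j)})"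
        using incr I unfolding free_elements_def by blast
    next
      fix i j assume "i \<in> {1..k}" "j \<in> {..<m}"
      with I show "generated_subalgebra smul {b i (I j)}
          \<subseteq> generated_subalgebra smul (b i ` half_open_intervals)"
        by (intro generated_subalgebra_mono) auto
    qed
    then have "free_subalgebras \<phi> {..<m} ?B"
      by (rule free_subalgebras_group) (auto intro: generated_subalgebra)
    then show "free_elements smul \<phi> {..<m} (\<lambda>j. \<Sum>i=1..k. b i (I j))"
      unfolding free_elements_def
    proof (rule free_subalgebras_mono)
      fix j assume j: "j \<in> {..<m}"
      have "b i (I j) \<in> ?B j" if "i \<in> {1..k}" for i
      proof (rule subsetD[OF generated_subalgebra_superset], rule UN_I)
        show "(i, j) \<in> {x\<in>{1..k} \<times> {..<m}. snd x = j}" using that j by simp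
        show "b i (I j) \<in> ?A (i, j)" using generated_subalgebra_superset[of "{b i (I j)}"] by simp
      qed
      then have "(\<Sum>i=1..k. b i (I j)) \<in> ?B j"
        by (intro subspace_sum unital_subalgebraD(1) generated_subalgebra)
      then show "generated_subalgebra smul {\<Sum>i=1..k. b i (I j)} \<subseteq> ?B j"
        by (intro generated_subalgebra_least generated_subalgebra) simp
    qed simp
  qed
qed

end
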